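(* A displacement field $\mathbf{u}:\Omega\to\mathbb{R}^3$ is universal for the monoclinic class $\mathbb{Z}_2\oplus\mathbb{Z}_2^c$ of linear strain-gradient elastic solids if and only if it is the superposition (sum) of a homogeneous displacement field and a field $(c\,x_2x_3,\,-c\,x_1x_3,\,0)$ for some constant $c\in\mathbb{R}$.
   Context: $\Omega\subset\mathbb{R}^3$ is a nonempty convex open set with Cartesian coordinates $(x_1,x_2,x_3)$ and orthonormal basis $e_1,e_2,e_3$. Repeated indices are summed over $1,2,3$ and a comma denotes partial differentiation. A displacement field is a smooth map $\mathbf{u}:\Omega\to\mathbb{R}^3$, with strain $e_{lm}=\tfrac12(u_{l,m}+u_{m,l})$. It is homogeneous if $\mathbf{u}(\mathbf{x})=\mathbf{H}\mathbf{x}+\mathbf{b}$ for a constant matrix $\mathbf{H}$ and constant vector $\mathbf{b}$. A strain-gradient material is a triple $(\mathsf{C},\mathsf{M},\mathsf{A})$ of constant real tensors of orders $4,5,6$ with index symmetries $\mathsf{C}_{ijlm}=\mathsf{C}_{jilm}=\mathsf{C}_{lmij}$, $\mathsf{M}_{ijklm}=\mathsf{M}_{jiklm}=\mathsf{M}_{ijlkm}$, $\mathsf{A}_{ijklmn}=\mathsf{A}_{jiklmn}=\mathsf{A}_{lmnijk}$. Its stress and hyper-stress are $\sigma_{ij}=\mathsf{C}_{ijlm}e_{lm}+\mathsf{M}_{ijlmn}e_{lm,n}$ and $\tau_{ijk}=\mathsf{M}_{lmijk}e_{lm}+\mathsf{A}_{ijklmn}e_{lm,n}$, and the equilibrium equations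 without body forces are $\sigma_{ij,j}-\tau_{ijk,jk}=0$ in $\Omega$ for $i=1,2,3$. For a subgroup $G\subset \mathrm{O}(3)$, a tensor $T$ of order $p$ is $G$-invariant if $Q_{i_1j_1}\cdots Q_{i_pj_p}T_{j_1\dots j_p}=T_{i_1\dots i_p}$ for all $Q\in G$. $\mathbb{Z}_2$ is the group generated by the rotation by $\pi$ about $e_3$, $\mathbb{Z}_2^c=\{I,-I\}$, and $\mathbb{Z}_2\oplus\mathbb{Z}_2^c$ is the group generated by both. The monoclinic class $\mathbb{Z}_2\oplus\mathbb{Z}_2^c$ is the set of all materials with $\mathsf{C}$ and $\mathsf{A}$ $\mathbb{Z}_2\oplus\mathbb{Z}_2^c$-invariant (13 and 91 independent constants) and $\mathsf{M}=0$. A displacement field is universal for the class if it satisfies the equilibrium equations for every material in the class. *)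

theory Defs
  imports "HOL-Analysis.Analysis" "HOL-Algebra.Generated_Groups"
begin

text \<open>A field on an open set \<open>\<Omega>\<close> is a total function of which only the values on \<open>\<Omega>\<close>
  are used: on an open set all derivatives below are determined by these values.
  \<open>Ck_on n \<Omega> f\<close> says that \<open>f\<close> is \<open>n\<close> times continuously differentiable on \<open>\<Omega>\<close>.\<close>

primrec Ck_on ::
  "nat \<Rightarrow> 'a::real_normed_vector set \<Rightarrow> ('a \<Rightarrow> 'b::real_normed_vector) \<Rightarrow> bool" where
  "Ck_on 0 \<Omega> f \<longleftrightarrow> continuous_on \<Omega> f"
| "Ck_on (Suc n) \<Omega> f \<longleftrightarrow> (\<forall>x\<in>\<Omega>. f differentiable (at x)) \<and>
     (\<forall>v. Ck_on n \<Omega> (\<lambda>x. frechet_derivative f (at x) v))"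

definition displacement_field :: "(real^3) set \<Rightarrow> (real^3 \<Rightarrow> real^3) \<Rightarrow> bool" where
  "displacement_field \<Omega> u \<longleftrightarrow> (\<forall>n. Ck_on n \<Omega> u)"

definition homogeneous_displacement :: "(real^3) set \<Rightarrow> (real^3 \<Rightarrow> real^3) \<Rightarrow> bool" where
  "homogeneous_displacement \<Omega> u \<longleftrightarrow>
     (\<exists>(H :: real^3^3) (b :: real^3). \<forall>x\<in>\<Omega>. u x = H *v x + b)"

definition partial_deriv :: "3 \<Rightarrow> (real^3 \<Rightarrow> real) \<Rightarrow> real^3 \<Rightarrow> real" where
  "partial_deriv k f x = frechet_derivative f (at x) (axis k 1)"

type_synonym tensor4 = "3 \<Rightarrow> 3 \<Rightarrow> 3 \<Rightarrow> 3 \<Rightarrow> real"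
type_synonym tensor5 = "3 \<Rightarrow> 3 \<Rightarrow> 3 \<Rightarrow> 3 \<Rightarrow> 3 \<Rightarrow> real"
type_synonym tensor6 = "3 \<Rightarrow> 3 \<Rightarrow> 3 \<Rightarrow> 3 \<Rightarrow> 3 \<Rightarrow> 3 \<Rightarrow> real"
type_synonym material = "tensor4 \<times> tensor5 \<times> tensor6"

definition strain_gradient_materials :: "material set" where
  "strain_gradient_materials = {(C, M, A).
     (\<forall>i j l m. C i j l m = C j i l m \<and> C i j l m = C l m i j) \<and>
     (\<forall>i j k l m. M i j k l m = M j i k l m \<and> M i j k l m = M i j l k m) \<and>
     (\<forall>i j k l m n. A i j k l m n = A j i k l m n \<and> A i j k l m n = A l m n i j k)}"

definition strain :: "(real^3 \<Rightarrow> real^3) \<Rightarrow> 3 \<Rightarrow> 3 \<Rightarrow> real^3 \<Rightarrow> real" where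
  "strain u l m x =
     (partial_deriv m (\<lambda>y. u y $ l) x + partial_deriv l (\<lambda>y. u y $ m) x) / 2"

fun stress :: "material \<Rightarrow> (real^3 \<Rightarrow> real^3) \<Rightarrow> 3 \<Rightarrow> 3 \<Rightarrow> real^3 \<Rightarrow> real" where
  "stress (C, M, A) u i j x =
     (\<Sum>l\<in>UNIV. \<Sum>m\<in>UNIV. C i j l m * strain u l m x) +
     (\<Sum>l\<in>UNIV. \<Sum>m\<in>UNIV. \<Sum>n\<in>UNIV. M i j l m n * partial_deriv n (strain u l m) x)"

fun hyper_stress :: "material \<Rightarrow> (real^3 \<Rightarrow> real^3) \<Rightarrow> 3 \<Rightarrow> 3 \<Rightarrow> 3 \<Rightarrow> real^3 \<Rightarrow> real" where
  "hyper_stress (C, M, A) u i j k x =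
     (\<Sum>l\<in>UNIV. \<Sum>m\<in>UNIV. M l m i j k * strain u l m x) +
     (\<Sum>l\<in>UNIV. \<Sum>m\<in>UNIV. \<Sum>n\<in>UNIV. A i j k l m n * partial_deriv n (strain u l m) x)"

definition equilibrium :: "(real^3) set \<Rightarrow> material \<Rightarrow> (real^3 \<Rightarrow> real^3) \<Rightarrow> bool" where
  "equilibrium \<Omega> \<mu> u \<longleftrightarrow> (\<forall>x\<in>\<Omega>. \<forall>i.
     (\<Sum>j\<in>UNIV. partial_deriv j (stress \<mu> u i j) x) -
     (\<Sum>j\<in>UNIV. \<Sum>k\<in>UNIV. partial_deriv k (partial_deriv j (hyper_stress \<mu> u i j k)) x) = 0)"

definition universal_displacement ::
  "(real^3) set \<Rightarrow> material set \<Rightarrow> (real^3 \<Rightarrow> real^3) \<Rightarrow> bool" where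
  "universal_displacement \<Omega> K u \<longleftrightarrow> (\<forall>\<mu>\<in>K. equilibrium \<Omega> \<mu> u)"

definition invariant4 :: "(real^3^3) set \<Rightarrow> tensor4 \<Rightarrow> bool" where
  "invariant4 G T \<longleftrightarrow> (\<forall>Q\<in>G. \<forall>i1 i2 i3 i4.
     (\<Sum>j1\<in>UNIV. \<Sum>j2\<in>UNIV. \<Sum>j3\<in>UNIV. \<Sum>j4\<in>UNIV.
        Q$i1$j1 * Q$i2$j2 * Q$i3$j3 * Q$i4$j4 * T j1 j2 j3 j4) = T i1 i2 i3 i4)"

definition invariant6 :: "(real^3^3) set \<Rightarrow> tensor6 \<Rightarrow> bool" where
  "invariant6 G T \<longleftrightarrow> (\<forall>Q\<in>G. \<forall>i1 i2 i3 i4 i5 i6.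
     (\<Sum>j1\<in>UNIV. \<Sum>j2\<in>UNIV. \<Sum>j3\<in>UNIV. \<Sum>j4\<in>UNIV. \<Sum>j5\<in>UNIV. \<Sum>j6\<in>UNIV.
        Q$i1$j1 * Q$i2$j2 * Q$i3$j3 * Q$i4$j4 * Q$i5$j5 * Q$i6$j6 * T j1 j2 j3 j4 j5 j6)
     = T i1 i2 i3 i4 i5 i6)"

definition O3 :: "(real^3^3) monoid" where
  "O3 = \<lparr>carrier = {Q. orthogonal_matrix Q}, mult = (**), one = mat 1\<rparr>"

definition rotation_e3 :: "real \<Rightarrow> real^3^3" where
  "rotation_e3 t = vector [vector [cos t, - sin t, 0],
                           vector [sin t,   cos t, 0],
                           vector [    0,       0, 1]]"

definition Z2 :: "(real^3^3) set" where
  "Z2 = generate O3 {rotation_e3 pi}"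

definition Z2c :: "(real^3^3) set" where
  "Z2c = {mat 1, - mat 1}"

definition Z2_Z2c :: "(real^3^3) set" where
  "Z2_Z2c = generate O3 (Z2 \<union> Z2c)"

text \<open>\<open>generate\<close> uses the inverse of the ambient structure, so \<open>O3\<close> has to be a group.\<close>

lemma group_O3: "group O3"
proof (rule groupI)
  fix Q assume "Q \<in> carrier O3"
  then have "transpose Q \<in> carrier O3" "transpose Q \<otimes>\<^bsub>O3\<^esub> Q = \<one>\<^bsub>O3\<^esub>"
    by (auto simp: O3_def orthogonal_matrix_def)
  then show "\<exists>P\<in>carrier O3. P \<otimes>\<^bsub>O3\<^esub> Q = \<one>\<^bsub>O3\<^esub>" by blast
qed (auto simp: O3_def orthogonal_matrix_mul orthogonal_matrix_id matrix_mul_assoc)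

definition monoclinic_class :: "material set" where
  "monoclinic_class = {(C, M, A) \<in> strain_gradient_materials.
     invariant4 Z2_Z2c C \<and> M = (\<lambda>i j k l m. 0) \<and> invariant6 Z2_Z2c A}"

end

theory Submission
  imports Defs
begin

text \<open>Write \<open>e\<close> for the strain of \<open>u\<close>. With \<open>A = 0\<close>, testing the equilibrium equations against
  single monoclinic stiffness constants \<open>C\<close> gives that all first derivatives of \<open>e\<close> vanish
  except \<open>e\<^sub>1\<^sub>3\<^sub>,\<^sub>2 = - e\<^sub>2\<^sub>3\<^sub>,\<^sub>1\<close>. Since partial derivatives commute, the gradient of \<open>e\<^sub>1\<^sub>3\<^sub>,\<^sub>2\<close>
  vanishes, so it is a constant. The identity
  \<open>u\<^sub>i\<^sub>,\<^sub>j\<^sub>k = e\<^sub>i\<^sub>j\<^sub>,\<^sub>k + e\<^sub>i\<^sub>k\<^sub>,\<^sub>j - e\<^sub>j\<^sub>k\<^sub>,\<^sub>i\<close> then shows that the second derivatives of \<open>u\<close> are those of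
  \<open>(c x\<^sub>2 x\<^sub>3, - c x\<^sub>1 x\<^sub>3, 0)\<close>, and by convexity of \<open>\<Omega>\<close> the two fields differ by an
  affine one. Conversely such a \<open>u\<close> has affine strain, so the hyper-stress is constant and \<open>A\<close>
  drops out, while the divergence of the stress vanishes by the symmetries of \<open>C\<close>.\<close>

subsection \<open>The field \<open>(c x\<^sub>2 x\<^sub>3, - c x\<^sub>1 x\<^sub>3, 0)\<close>\<close>

text \<open>The factor 1/2 makes a symmetric \<open>B\<close> exactly the matrix of second
  derivatives.\<close>

definition quadratic :: "(3 \<Rightarrow> 3 \<Rightarrow> real) \<Rightarrow> (3 \<Rightarrow> real) \<Rightarrow> real \<Rightarrow> real^3 \<Rightarrow> real" where
  "quadratic B h b x =
     (\<Sum>j\<in>UNIV. \<Sum>k\<in>UNIV. B j k / 2 * (x $ j * x $ k)) + (\<Sum>j\<in>UNIV. h j * x $ j) + b"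

text \<open>The second derivatives \<open>u\<^sub>i\<^sub>,\<^sub>j\<^sub>k\<close> of the field in the heading.\<close>

definition twist :: "real \<Rightarrow> 3 \<Rightarrow> 3 \<Rightarrow> 3 \<Rightarrow> real" where
  "twist c i j k =
     (if i = 1 \<and> (j, k) \<in> {(2, 3), (3, 2)} then c
      else if i = 2 \<and> (j, k) \<in> {(1, 3), (3, 1)} then - c else 0)"

lemma twist_symmetric: "twist c i j k = twist c i k j"
proof -
  have "(j, k) \<in> {(a, b), (b, a)} \<longleftrightarrow> (k, j) \<in> {(a, b), (b, a)}" for a b
    by auto
  then show ?thesis
    unfolding twist_def by (simp only:)
qed

text \<open>The entry \<open>c\<close> of \<open>twist\<close> occurs at both \<open>(2, 3)\<close>
  and \<open>(3, 2)\<close>, each time halved in \<open>quadratic\<close>, which adds up to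
  \<open>c * x$2 * x$3\<close>; likewise for the second component.\<close>

lemma affine_plus_twist_nth:
  "(H *v x + b + vector [c * x$2 * x$3, - c * x$1 * x$3, 0]) $ i =
    quadratic (twist c i) (\<lambda>j. H $ i $ j) (b $ i) x"
  using exhaust_3[of i]
  by (auto simp: quadratic_def twist_def matrix_vector_mult_def sum_3 field_simps)

text \<open>This reads the claimed form of \<open>u\<close> componentwise. The constant
  \<open>c\<close> is quantified before \<open>i\<close> because it couples the first two
  components, while \<open>h\<close> and \<open>b\<close> may depend on \<open>i\<close>.\<close>

lemma quadratic_twist_iff_homogeneous_plus_twist:
  "(\<exists>c. \<forall>i. \<exists>h b. \<forall>x\<in>\<Omega>. u x $ i = quadratic (twist c i) h b x) \<longleftrightarrow>
    (\<exists>v c. homogeneous_displacement \<Omega> v \<and>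
      (\<forall>x\<in>\<Omega>. u x = v x + vector [c * x$2 * x$3, - c * x$1 * x$3, 0]))"
proof -
  have "(\<exists>c. \<forall>i. \<exists>h b. \<forall>x\<in>\<Omega>. u x $ i = quadratic (twist c i) h b x) \<longleftrightarrow>
      (\<exists>c H b. \<forall>x\<in>\<Omega>. u x = H *v x + b + vector [c * x$2 * x$3, - c * x$1 * x$3, 0])"
  proof (intro ex_cong1 iffI)
    fix c assume "\<forall>i. \<exists>h b. \<forall>x\<in>\<Omega>. u x $ i = quadratic (twist c i) h b x"
    \<comment> \<open>Choosing \<open>h\<close> and \<open>b\<close> for every \<open>i\<close>
      supplies the rows of the matrix and the entries of the translation.\<close>
    then obtain h b where hb: "\<And>i x. x \<in> \<Omega> \<Longrightarrow> u x $ i = quadratic (twist c i) (h i) (b i) x"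
      by metis
    have "u x = (\<chi> i j. h i j) *v x + (\<chi> i. b i) + vector [c * x$2 * x$3, - c * x$1 * x$3, 0]"
      if "x \<in> \<Omega>" for x
      unfolding vec_eq_iff affine_plus_twist_nth using hb[OF that] by (simp add: vec_lambda_inverse)
    then show "\<exists>H b. \<forall>x\<in>\<Omega>. u x = H *v x + b + vector [c * x$2 * x$3, - c * x$1 * x$3, 0]"
      by blast
  next
    fix c assume "\<exists>H b. \<forall>x\<in>\<Omega>. u x = H *v x + b + vector [c * x$2 * x$3, - c * x$1 * x$3, 0]"
    then show "\<forall>i. \<exists>h b. \<forall>x\<in>\<Omega>. u x $ i = quadratic (twist c i) h b x"
      using affine_plus_twist_nth by metis
  qed
  also have "\<dots> \<longleftrightarrow> (\<exists>v c. homogeneous_displacement \<Omega> v \<and>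
      (\<forall>x\<in>\<Omega>. u x = v x + vector [c * x$2 * x$3, - c * x$1 * x$3, 0]))"
    (is "?L \<longleftrightarrow> ?R")
  proof
    assume ?L
    then obtain c H b
      where "\<forall>x\<in>\<Omega>. u x = H *v x + b + vector [c * x$2 * x$3, - c * x$1 * x$3, 0]"
      by blast
    moreover have "homogeneous_displacement \<Omega> (\<lambda>x. H *v x + b)"
      unfolding homogeneous_displacement_def by blast
    ultimately show ?R
      by (intro exI[of _ "\<lambda>x. H *v x + b"] exI[of _ c] conjI)
  next
    assume ?R
    then obtain v c H b where "\<forall>x\<in>\<Omega>. v x = H *v x + b"
      and "\<forall>x\<in>\<Omega>. u x = v x + vector [c * x$2 * x$3, - c * x$1 * x$3, 0]"
      unfolding homogeneous_displacement_def by blast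
    then have "\<forall>x\<in>\<Omega>. u x = H *v x + b + vector [c * x$2 * x$3, - c * x$1 * x$3, 0]"
      by simp
    then show ?L by blast
  qed
  finally show ?thesis .
qed

subsection \<open>Smooth fields and symmetry of second derivatives\<close>

lemma has_derivative_frechet:
  "f differentiable (at x) \<Longrightarrow> (f has_derivative frechet_derivative f (at x)) (at x)"
  by (simp flip: frechet_derivative_works)

text \<open>Fields are total functions whose values off \<open>S\<close> are arbitrary. Derivatives
  at points of an open set are local, so equations that hold only on \<open>S\<close> may be
  differentiated.\<close>

lemma has_derivative_cong_open:
  assumes "open S" "x \<in> S" "\<And>y. y \<in> S \<Longrightarrow> f y = g y"
  shows "(f has_derivative D) (at x) \<longleftrightarrow> (g has_derivative D) (at x)"
  using has_derivative_transform_within_open[of f D x UNIV S g]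
    has_derivative_transform_within_open[of g D x UNIV S f] assms by auto

lemma frechet_derivative_cong_open:
  assumes "open S" "x \<in> S" "\<And>y. y \<in> S \<Longrightarrow> f y = g y"
  shows "frechet_derivative f (at x) = frechet_derivative g (at x)"
  by (simp add: frechet_derivative_def has_derivative_cong_open[OF assms])

lemma differentiable_cong_open:
  assumes "open S" "x \<in> S" "\<And>y. y \<in> S \<Longrightarrow> f y = g y"
  shows "f differentiable (at x) \<longleftrightarrow> g differentiable (at x)"
  by (simp add: differentiable_def has_derivative_cong_open[OF assms])

lemma Ck_on_cong:
  assumes "open S" "\<And>y. y \<in> S \<Longrightarrow> f y = g y"
  shows "Ck_on n S f \<longleftrightarrow> Ck_on n S g"
  using assms(2)
proof (induction n arbitrary: f g)
  case 0
  then show ?case by (simp cong: continuous_on_cong)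
next
  case (Suc n)
  have "Ck_on n S (\<lambda>x. frechet_derivative f (at x) v) \<longleftrightarrow>
      Ck_on n S (\<lambda>x. frechet_derivative g (at x) v)" for v
    by (rule Suc.IH) (simp add: frechet_derivative_cong_open[OF assms(1) _ Suc.prems])
  then show ?case
    using differentiable_cong_open[OF assms(1) _ Suc.prems] by simp
qed

text \<open>The derivative of the composite is \<open>L\<close> applied to the derivative of
  \<open>f\<close>, but this is known only on \<open>S\<close>; hence the induction step passes
  through \<open>Ck_on_cong\<close>.\<close>

lemma Ck_on_bounded_linear:
  assumes "open S" "bounded_linear L" "Ck_on n S f"
  shows "Ck_on n S (\<lambda>x. L (f x))"
  using assms(3)
proof (induction n arbitrary: f)
  case 0
  then show ?case
    using bounded_linear.continuous_on[OF assms(2)] by simp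
next
  case (Suc n)
  have D: "((\<lambda>x. L (f x)) has_derivative (\<lambda>v. L (frechet_derivative f (at x) v))) (at x)"
    if "x \<in> S" for x
    using Suc.prems that
    by (intro bounded_linear.has_derivative[OF assms(2)] has_derivative_frechet) simp_all
  have "Ck_on n S (\<lambda>x. frechet_derivative (\<lambda>x. L (f x)) (at x) v)" for v
  proof (subst Ck_on_cong[OF assms(1)])
    show "Ck_on n S (\<lambda>x. L (frechet_derivative f (at x) v))"
      using Suc by simp
  qed (simp flip: frechet_derivative_at[OF D])
  then show ?case
    using D by (auto simp: differentiable_def)
qed

lemma Ck_on_add:
  assumes "open S" "Ck_on n S f" "Ck_on n S g"
  shows "Ck_on n S (\<lambda>x. f x + g x)"
  using assms(2,3)
proof (induction n arbitrary: f g)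
  case 0
  then show ?case by (simp add: continuous_on_add)
next
  case (Suc n)
  have D: "((\<lambda>x. f x + g x) has_derivative
      (\<lambda>v. frechet_derivative f (at x) v + frechet_derivative g (at x) v)) (at x)"
    if "x \<in> S" for x
    using Suc.prems that by (intro has_derivative_add has_derivative_frechet) simp_all
  have "Ck_on n S (\<lambda>x. frechet_derivative (\<lambda>x. f x + g x) (at x) v)" for v
  proof (subst Ck_on_cong[OF assms(1)])
    show "Ck_on n S (\<lambda>x. frechet_derivative f (at x) v + frechet_derivative g (at x) v)"
      using Suc by simp
  qed (simp flip: frechet_derivative_at[OF D])
  then show ?case
    using D by (auto simp: differentiable_def)
qed

section \<open>Symmetry of mixed second derivatives\<close>

text \<open>The mean value theorem is applied twice, first along \<open>v\<close> to a difference of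
  values of \<open>f\<close>, then along \<open>w\<close> to the derivative in direction
  \<open>v\<close>. The second difference on the left is symmetric in \<open>v\<close> and
  \<open>w\<close>, so it also computes the derivative taken in the other order.\<close>

lemma second_difference_mean_value:
  fixes f :: "'a::real_normed_vector \<Rightarrow> real"
  assumes S: "\<And>s t. s \<in> {0..h} \<Longrightarrow> t \<in> {0..h} \<Longrightarrow> x + s *\<^sub>R v + t *\<^sub>R w \<in> S"
    and f: "\<And>y. y \<in> S \<Longrightarrow> f differentiable (at y)"
    and df: "\<And>y. y \<in> S \<Longrightarrow> (\<lambda>z. frechet_derivative f (at z) v) differentiable (at y)"
    and h: "0 < h"
  shows "\<exists>s\<in>{0<..<h}. \<exists>t\<in>{0<..<h}.
    f (x + h *\<^sub>R v + h *\<^sub>R w) - f (x + h *\<^sub>R v) - f (x + h *\<^sub>R w) + f x =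
    h * h * frechet_derivative (\<lambda>z. frechet_derivative f (at z) v)
      (at (x + s *\<^sub>R v + t *\<^sub>R w)) w"
proof -
  let ?Df = "\<lambda>z. frechet_derivative f (at z)"
  let ?D2 = "\<lambda>z. frechet_derivative (\<lambda>z. ?Df z v) (at z)"
  have line: "((\<lambda>s. a + s *\<^sub>R b) has_derivative (\<lambda>r. r *\<^sub>R b)) F" for a b :: 'a and F
    by (auto intro!: derivative_eq_intros)
  have chain: "((\<lambda>s. g (a + s *\<^sub>R b)) has_real_derivative frechet_derivative g (at (a + s *\<^sub>R b)) b)
      (at s)" if "g differentiable (at (a + s *\<^sub>R b))" for g :: "'a \<Rightarrow> real" and a b s
  proof -
    have g: "(g has_derivative frechet_derivative g (at (a + s *\<^sub>R b))) (at (a + s *\<^sub>R b))"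
      using that frechet_derivative_works by blast
    have "((\<lambda>s. g (a + s *\<^sub>R b)) has_derivative
        (\<lambda>r. frechet_derivative g (at (a + s *\<^sub>R b)) (r *\<^sub>R b))) (at s)"
      by (rule has_derivative_compose[OF line g])
    moreover have "(\<lambda>r. frechet_derivative g (at (a + s *\<^sub>R b)) (r *\<^sub>R b)) =
        (*) (frechet_derivative g (at (a + s *\<^sub>R b)) b)"
      using linear_cmul[OF has_derivative_linear[OF g]] by (auto simp: fun_eq_iff)
    ultimately show ?thesis
      by (simp add: has_field_derivative_def)
  qed
  \<comment> \<open>The second difference is the increment over \<open>{0..h}\<close> of \<open>f (x
    + h *\<^sub>R w + s *\<^sub>R v) - f (x + s *\<^sub>R v)\<close> as a function of
    \<open>s\<close>.\<close>
  have "\<exists>s>0. s < h \<and> (f (x + h *\<^sub>R w + h *\<^sub>R v) - f (x + h *\<^sub>R v)) -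
      (f (x + h *\<^sub>R w + 0 *\<^sub>R v) - f (x + 0 *\<^sub>R v)) =
      (h - 0) * (?Df (x + h *\<^sub>R w + s *\<^sub>R v) v - ?Df (x + s *\<^sub>R v) v)"
  proof (rule MVT2[OF h])
    fix s assume "0 \<le> s" "s \<le> h"
    then have "f differentiable at (x + h *\<^sub>R w + s *\<^sub>R v)" "f differentiable at (x + s *\<^sub>R v)"
      using S[of s h] S[of s 0] f h by (auto simp: add_ac)
    then show "((\<lambda>s. f (x + h *\<^sub>R w + s *\<^sub>R v) - f (x + s *\<^sub>R v)) has_real_derivative
        (?Df (x + h *\<^sub>R w + s *\<^sub>R v) v - ?Df (x + s *\<^sub>R v) v)) (at s)"
      by (intro DERIV_diff chain)
  qed
  then obtain s where s: "0 < s" "s < h" and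
    eq1: "f (x + h *\<^sub>R w + h *\<^sub>R v) - f (x + h *\<^sub>R v) - f (x + h *\<^sub>R w) + f x =
      h * (?Df (x + s *\<^sub>R v + h *\<^sub>R w) v - ?Df (x + s *\<^sub>R v) v)"
    by (force simp: add_ac)
  have "\<exists>t>0. t < h \<and> ?Df (x + s *\<^sub>R v + h *\<^sub>R w) v - ?Df (x + s *\<^sub>R v + 0 *\<^sub>R w) v =
      (h - 0) * ?D2 (x + s *\<^sub>R v + t *\<^sub>R w) w"
  proof (rule MVT2[OF h])
    fix t assume "0 \<le> t" "t \<le> h"
    then show "((\<lambda>t. ?Df (x + s *\<^sub>R v + t *\<^sub>R w) v) has_real_derivative
        ?D2 (x + s *\<^sub>R v + t *\<^sub>R w) w) (at t)"
      using S[of s t] df s by (intro chain[where g = "\<lambda>z. ?Df z v"]) auto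
  qed
  then obtain t where "0 < t" "t < h"
    "?Df (x + s *\<^sub>R v + h *\<^sub>R w) v - ?Df (x + s *\<^sub>R v) v = h * ?D2 (x + s *\<^sub>R v + t *\<^sub>R w) w"
    by auto
  with eq1 s show ?thesis
    by (intro bexI[of _ s] bexI[of _ t]) (auto simp: add_ac)
qed

text \<open>The second difference divided by \<open>h * h\<close> equals each mixed derivative at
  some point near \<open>x\<close>. By continuity both mixed derivatives at \<open>x\<close> are
  then arbitrarily close to one common number.\<close>

lemma mixed_derivatives_commute:
  fixes f :: "'a::real_normed_vector \<Rightarrow> real"
  assumes S: "open S" "x \<in> S" and f: "Ck_on 2 S f"
  shows "frechet_derivative (\<lambda>z. frechet_derivative f (at z) v) (at x) w =
    frechet_derivative (\<lambda>z. frechet_derivative f (at z) w) (at x) v"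
proof (rule ccontr)
  let ?D = "\<lambda>v w z. frechet_derivative (\<lambda>z. frechet_derivative f (at z) v) (at z) w"
  assume ne: "\<not> ?thesis"
  \<comment> \<open>Half the distance: two errors below \<open>e\<close> cannot bridge the gap
    between the two values.\<close>
  define e where "e = dist (?D v w x) (?D w v x) / 2"
  have e: "0 < e" using ne by (simp add: e_def)
  have f1: "f differentiable (at y)" if "y \<in> S" for y
    using f that by (simp add: numeral_2_eq_2)
  have f2: "(\<lambda>z. frechet_derivative f (at z) v) differentiable (at y)" if "y \<in> S" for y v
    using f that by (simp add: numeral_2_eq_2)
  have "continuous_on S (?D v w)" for v w
    using f by (simp add: numeral_2_eq_2)
  then have cont: "isCont (?D v w) x" for v w
    using S continuous_on_eq_continuous_at by blast
  obtain d1 where d1: "0 < d1" "\<And>y. dist y x < d1 \<Longrightarrow> dist (?D v w y) (?D v w x) < e"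
    using cont[of v w] e unfolding continuous_at_eps_delta by blast
  obtain d2 where d2: "0 < d2" "\<And>y. dist y x < d2 \<Longrightarrow> dist (?D w v y) (?D w v x) < e"
    using cont[of w v] e unfolding continuous_at_eps_delta by blast
  obtain d3 where d3: "0 < d3" "ball x d3 \<subseteq> S"
    using S open_contains_ball by blast
  define d where "d = min d1 (min d2 d3)"
  have d: "0 < d" "d \<le> d1" "d \<le> d2" "d \<le> d3"
    using d1 d2 d3 by (auto simp: d_def)
  \<comment> \<open>The parallelogram with sides \<open>h *\<^sub>R v\<close> and
    \<open>h *\<^sub>R w\<close> stays within \<open>d\<close> of \<open>x\<close>. The summand 1
    keeps the denominator positive for zero vectors and the estimate strict.\<close>
  define h where "h = d / (norm v + norm w + 1)"
  have h: "0 < h"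
    using d by (simp add: h_def add_nonneg_pos)
  have near: "dist (x + s *\<^sub>R v + t *\<^sub>R w) x < d" if "s \<in> {0..h}" "t \<in> {0..h}" for s t
  proof -
    have "dist (x + s *\<^sub>R v + t *\<^sub>R w) x = norm (s *\<^sub>R v + t *\<^sub>R w)"
      by (simp add: dist_norm add.assoc)
    also have "\<dots> \<le> s * norm v + t * norm w"
      using that by (intro norm_triangle_le) simp
    also have "\<dots> \<le> h * norm v + h * norm w"
      using that by (intro add_mono mult_right_mono) auto
    also have "\<dots> < h * (norm v + norm w + 1)"
      using h by (simp add: algebra_simps)
    also have "\<dots> = d"
      by (simp add: h_def add_nonneg_pos[THEN less_imp_neq, THEN not_sym])
    finally show ?thesis .
  qed
  have inS: "x + s *\<^sub>R v + t *\<^sub>R w \<in> S" if "s \<in> {0..h}" "t \<in> {0..h}" for s t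
    using near[OF that] d3 d by (auto simp: mem_ball dist_commute subset_iff)
  then have inS': "x + t *\<^sub>R w + s *\<^sub>R v \<in> S" if "t \<in> {0..h}" "s \<in> {0..h}" for s t
    using that by (simp add: add_ac)
  obtain s t where st: "s \<in> {0<..<h}" "t \<in> {0<..<h}" and
    eq1: "f (x + h *\<^sub>R v + h *\<^sub>R w) - f (x + h *\<^sub>R v) - f (x + h *\<^sub>R w) + f x =
      h * h * ?D v w (x + s *\<^sub>R v + t *\<^sub>R w)"
    using second_difference_mean_value[OF inS f1 f2 h] by blast
  obtain t' s' where st': "t' \<in> {0<..<h}" "s' \<in> {0<..<h}" and
    eq2: "f (x + h *\<^sub>R w + h *\<^sub>R v) - f (x + h *\<^sub>R w) - f (x + h *\<^sub>R v) + f x =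
      h * h * ?D w v (x + t' *\<^sub>R w + s' *\<^sub>R v)"
    using second_difference_mean_value[OF inS' f1 f2 h] by blast
  have comm: "x + h *\<^sub>R w + h *\<^sub>R v = x + h *\<^sub>R v + h *\<^sub>R w"
    "x + t' *\<^sub>R w + s' *\<^sub>R v = x + s' *\<^sub>R v + t' *\<^sub>R w"
    by (simp_all add: add_ac)
  have "h * h * ?D v w (x + s *\<^sub>R v + t *\<^sub>R w) = h * h * ?D w v (x + s' *\<^sub>R v + t' *\<^sub>R w)"
    using eq1 eq2 unfolding comm by linarith
  then have "?D v w (x + s *\<^sub>R v + t *\<^sub>R w) = ?D w v (x + s' *\<^sub>R v + t' *\<^sub>R w)"
    using h by simp
  moreover have "dist (?D v w (x + s *\<^sub>R v + t *\<^sub>R w)) (?D v w x) < e"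
    using st by (intro d1(2) less_le_trans[OF near d(2)]) auto
  moreover have "dist (?D w v (x + s' *\<^sub>R v + t' *\<^sub>R w)) (?D w v x) < e"
    using st' by (intro d2(2) less_le_trans[OF near d(3)]) auto
  ultimately show False
    using dist_triangle3[of "?D v w x" "?D w v x" "?D v w (x + s *\<^sub>R v + t *\<^sub>R w)"]
    unfolding e_def by simp
qed

subsection \<open>Partial derivatives and quadratic functions\<close>

text \<open>The condition of \<open>displacement_field\<close> at arbitrary types, so that
  components, strains and their derivatives are covered too.\<close>

definition smooth_on :: "'a::real_normed_vector set \<Rightarrow> ('a \<Rightarrow> 'b::real_normed_vector) \<Rightarrow> bool" where
  "smooth_on S f \<longleftrightarrow> (\<forall>n. Ck_on n S f)"

lemma smooth_on_bounded_linear: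
  "open S \<Longrightarrow> bounded_linear L \<Longrightarrow> smooth_on S f \<Longrightarrow> smooth_on S (\<lambda>x. L (f x))"
  using Ck_on_bounded_linear[of S L _ f] by (simp add: smooth_on_def)

lemma smooth_on_add:
  "open S \<Longrightarrow> smooth_on S f \<Longrightarrow> smooth_on S g \<Longrightarrow> smooth_on S (\<lambda>x. f x + g x)"
  using Ck_on_add[of S _ f g] by (simp add: smooth_on_def)

lemma smooth_on_partial_deriv: "smooth_on S f \<Longrightarrow> smooth_on S (partial_deriv k f)"
  unfolding smooth_on_def partial_deriv_def[abs_def] by (metis Ck_on.simps(2))

lemma smooth_on_differentiable: "smooth_on S f \<Longrightarrow> x \<in> S \<Longrightarrow> f differentiable (at x)"
  unfolding smooth_on_def by (metis Ck_on.simps(2))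

lemma partial_deriv_cong:
  assumes "open S" "x \<in> S" "\<And>y. y \<in> S \<Longrightarrow> f y = g y"
  shows "partial_deriv k f x = partial_deriv k g x"
  using frechet_derivative_cong_open[OF assms] by (simp add: partial_deriv_def)

lemma partial_deriv_eqI:
  "(f has_derivative f') (at x) \<Longrightarrow> partial_deriv k f x = f' (axis k 1)"
  unfolding partial_deriv_def using frechet_derivative_at by metis

lemma partial_deriv_const: "partial_deriv k (\<lambda>x. c) = (\<lambda>x. 0)"
  by (simp add: partial_deriv_def fun_eq_iff)

lemma partial_deriv_add:
  assumes "f differentiable (at x)" "g differentiable (at x)"
  shows "partial_deriv k (\<lambda>x. f x + g x) x = partial_deriv k f x + partial_deriv k g x"
  unfolding partial_deriv_def[of _ f] partial_deriv_def[of _ g]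
  by (intro partial_deriv_eqI has_derivative_add has_derivative_frechet assms)

lemma partial_deriv_cmult:
  assumes "f differentiable (at x)"
  shows "partial_deriv k (\<lambda>x. c * f x) x = c * partial_deriv k f x"
  unfolding partial_deriv_def[of _ f]
  by (intro partial_deriv_eqI has_derivative_mult_right has_derivative_frechet assms)

lemma partial_deriv_sum:
  assumes "\<And>i. i \<in> I \<Longrightarrow> f i differentiable (at x)"
  shows "partial_deriv k (\<lambda>x. \<Sum>i\<in>I. f i x) x = (\<Sum>i\<in>I. partial_deriv k (f i) x)"
  unfolding partial_deriv_def[of _ "f _"]
  by (intro partial_deriv_eqI has_derivative_sum has_derivative_frechet assms)

lemma partial_deriv_commute:
  assumes "open S" "x \<in> S" "smooth_on S f"
  shows "partial_deriv k (partial_deriv j f) x = partial_deriv j (partial_deriv k f) x"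
  using mixed_derivatives_commute[of S x f] assms
  unfolding smooth_on_def partial_deriv_def[abs_def] by blast

section \<open>Recovering functions from their partial derivatives\<close>

lemma frechet_derivative_partial_derivs:
  assumes "f differentiable (at x)"
  shows "frechet_derivative f (at x) v = (\<Sum>k\<in>UNIV. v $ k * partial_deriv k f x)"
proof -
  have lin: "linear (frechet_derivative f (at x))"
    using has_derivative_frechet[OF assms] has_derivative_linear by blast
  have "frechet_derivative f (at x) v = frechet_derivative f (at x) (\<Sum>k\<in>UNIV. v $ k *s axis k 1)"
    by (simp only: basis_expansion)
  also have "\<dots> = (\<Sum>k\<in>UNIV. v $ k * partial_deriv k f x)"
    by (simp add: linear_sum[OF lin] linear_cmul[OF lin] scalar_mult_eq_scaleR partial_deriv_def)
  finally show ?thesis .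
qed

text \<open>The partial derivatives determine the full derivative, so \<open>f - g\<close> has
  derivative zero and is constant on a convex set. Every use of the convexity of
  \<open>\<Omega>\<close> goes through this lemma.\<close>

lemma equal_partial_derivs_imp_differ_by_const:
  assumes "convex S"
    and f: "\<And>x. x \<in> S \<Longrightarrow> f differentiable (at x)"
    and g: "\<And>x. x \<in> S \<Longrightarrow> g differentiable (at x)"
    and eq: "\<And>x k. x \<in> S \<Longrightarrow> partial_deriv k f x = partial_deriv k g x"
  shows "\<exists>b. \<forall>x\<in>S. f x = g x + b"
proof -
  have "((\<lambda>x. f x - g x) has_derivative (\<lambda>v. 0)) (at x within S)" if "x \<in> S" for x
  proof -
    have "frechet_derivative f (at x) = frechet_derivative g (at x)"
      using that by (simp add: fun_eq_iff frechet_derivative_partial_derivs f g eq)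
    then have "((\<lambda>x. f x - g x) has_derivative (\<lambda>v. 0)) (at x)"
      using has_derivative_diff[OF has_derivative_frechet[OF f[OF that]]
          has_derivative_frechet[OF g[OF that]]]
      by simp
    then show ?thesis
      by (rule has_derivative_at_withinI)
  qed
  then have "\<exists>b. \<forall>x\<in>S. f x - g x = b"
    by (rule has_derivative_zero_constant[OF \<open>convex S\<close>])
  then obtain b where "\<forall>x\<in>S. f x - g x = b" ..
  then show ?thesis
    by (intro exI[of _ b]) (auto simp: algebra_simps)
qed

lemma has_derivative_vec_nth:
  "((\<lambda>x. x $ k) has_derivative (\<lambda>v. v $ k)) F"
  by (rule bounded_linear.has_derivative[OF bounded_linear_vec_nth has_derivative_ident])

lemma index3_distinct:
  "(1::3) \<noteq> 2" "(1::3) \<noteq> 3" "(2::3) \<noteq> 1" "(2::3) \<noteq> 3" "(3::3) \<noteq> 1" "(3::3) \<noteq> 2"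
  by simp_all

lemma linear_form_has_derivative:
  "((\<lambda>x::real^3. (\<Sum>k\<in>UNIV. a k * x $ k) + b) has_derivative (\<lambda>v. \<Sum>k\<in>UNIV. a k * v $ k)) (at x)"
  by (intro has_derivative_add_const has_derivative_sum has_derivative_mult_right has_derivative_vec_nth)

lemma partial_deriv_linear_form:
  "partial_deriv j (\<lambda>x. (\<Sum>k\<in>UNIV. a k * x $ k) + b) x = a j"
  unfolding partial_deriv_eqI[OF linear_form_has_derivative]
  using exhaust_3[of j] by (auto simp: sum_3 axis_def)

lemma quadratic_has_derivative:
  "(quadratic B h b has_derivative
     (\<lambda>v. (\<Sum>j\<in>UNIV. \<Sum>k\<in>UNIV. B j k / 2 * (x $ j * v $ k + v $ j * x $ k)) +
       (\<Sum>j\<in>UNIV. h j * v $ j))) (at x)"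
  unfolding quadratic_def[abs_def]
  by (intro has_derivative_add_const has_derivative_add has_derivative_sum
      has_derivative_mult_right has_derivative_mult has_derivative_vec_nth)

lemma partial_deriv_quadratic:
  assumes sym: "\<And>j k. B j k = B k j"
  shows "partial_deriv j (quadratic B h b) x = (\<Sum>k\<in>UNIV. B j k * x $ k) + h j"
  unfolding partial_deriv_eqI[OF quadratic_has_derivative]
  using exhaust_3[of j] sym[of 2 1] sym[of 3 1] sym[of 3 2]
  by (auto simp: sum_3 axis_def algebra_simps)

text \<open>Forwards this is integrating twice: the constants of the first integration form
  \<open>h\<close>, the constant of the second is \<open>b\<close>.\<close>

lemma constant_second_partial_derivs_iff_quadratic:
  assumes S: "open S" "convex S" and f: "smooth_on S f"
    and sym: "\<And>j k. B j k = B k j"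
  shows "(\<forall>x\<in>S. \<forall>j k. partial_deriv k (partial_deriv j f) x = B j k) \<longleftrightarrow>
    (\<exists>h b. \<forall>x\<in>S. f x = quadratic B h b x)"
proof
  assume B: "\<forall>x\<in>S. \<forall>j k. partial_deriv k (partial_deriv j f) x = B j k"
  \<comment> \<open>The summand 0 brings the comparison function into the affine form of
    \<open>partial_deriv_linear_form\<close>.\<close>
  have "\<exists>b. \<forall>x\<in>S. partial_deriv j f x = ((\<Sum>k\<in>UNIV. B j k * x $ k) + 0) + b" for j
  proof (rule equal_partial_derivs_imp_differ_by_const[OF S(2)])
    fix x assume x: "x \<in> S"
    show "partial_deriv j f differentiable (at x)"
      using f x smooth_on_partial_deriv smooth_on_differentiable by blast
    show "(\<lambda>x. (\<Sum>k\<in>UNIV. B j k * x $ k) + 0) differentiable at x"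
      using linear_form_has_derivative unfolding differentiable_def by blast
    show "partial_deriv k (partial_deriv j f) x =
        partial_deriv k (\<lambda>x. (\<Sum>k\<in>UNIV. B j k * x $ k) + 0) x" for k
      unfolding partial_deriv_linear_form using B x by blast
  qed
  then obtain h where h: "\<And>j x. x \<in> S \<Longrightarrow> partial_deriv j f x = (\<Sum>k\<in>UNIV. B j k * x $ k) + h j"
    by simp metis
  have "\<exists>b. \<forall>x\<in>S. f x = quadratic B h 0 x + b"
  proof (rule equal_partial_derivs_imp_differ_by_const[OF S(2)])
    show "quadratic B h 0 differentiable (at x)" for x
      using quadratic_has_derivative unfolding differentiable_def by blast
  qed (use f smooth_on_differentiable in \<open>auto simp: h partial_deriv_quadratic[OF sym]\<close>)
  moreover have "quadratic B h 0 x + b = quadratic B h b x" for b x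
    by (simp add: quadratic_def)
  ultimately show "\<exists>h b. \<forall>x\<in>S. f x = quadratic B h b x"
    by auto
next
  assume "\<exists>h b. \<forall>x\<in>S. f x = quadratic B h b x"
  then obtain h b where q: "\<And>x. x \<in> S \<Longrightarrow> f x = quadratic B h b x" by blast
  have D: "partial_deriv j f x = (\<Sum>k\<in>UNIV. B j k * x $ k) + h j" if "x \<in> S" for j x
    by (subst partial_deriv_cong[OF S(1) that q]) (simp_all add: partial_deriv_quadratic[OF sym])
  show "\<forall>x\<in>S. \<forall>j k. partial_deriv k (partial_deriv j f) x = B j k"
  proof (intro ballI allI)
    fix x j k assume x: "x \<in> S"
    show "partial_deriv k (partial_deriv j f) x = B j k"
      by (subst partial_deriv_cong[OF S(1) x D]) (simp_all add: partial_deriv_linear_form)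
  qed
qed

abbreviation second_deriv ::
    "(real^3 \<Rightarrow> real^3) \<Rightarrow> 3 \<Rightarrow> 3 \<Rightarrow> 3 \<Rightarrow> real^3 \<Rightarrow> real" where
  "second_deriv u i j k \<equiv> partial_deriv k (partial_deriv j (\<lambda>y. u y $ i))"

lemma smooth_component:
  assumes \<Omega>: "open \<Omega>" and u: "displacement_field \<Omega> u"
  shows "smooth_on \<Omega> (\<lambda>y. u y $ i)"
  using smooth_on_bounded_linear[OF \<Omega> bounded_linear_vec_nth, of u] u
  by (simp add: smooth_on_def displacement_field_def)

lemma second_derivs_twist_iff_quadratic:
  assumes \<Omega>: "open \<Omega>" "convex \<Omega>" and u: "displacement_field \<Omega> u"
  shows "(\<exists>c. \<forall>i. \<forall>x\<in>\<Omega>. \<forall>j k. second_deriv u i j k x = twist c i j k) \<longleftrightarrow>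
    (\<exists>c. \<forall>i. \<exists>h b. \<forall>x\<in>\<Omega>. u x $ i = quadratic (twist c i) h b x)"
  using constant_second_partial_derivs_iff_quadratic[OF \<Omega> smooth_component[OF \<Omega>(1) u] twist_symmetric]
  by simp

subsection \<open>The monoclinic symmetry group\<close>

definition diagonal_matrix :: "(3 \<Rightarrow> real) \<Rightarrow> real^3^3" where
  "diagonal_matrix q = (\<chi> i j. if j = i then q i else 0)"

text \<open>The diagonal of diag(s, s, t): the rotation by pi about the third axis has
  \<open>s = -1\<close>, \<open>t = 1\<close>, and the inversion has
  \<open>s = t = -1\<close>.\<close>

definition axis3_sign :: "real \<Rightarrow> real \<Rightarrow> 3 \<Rightarrow> real" where
  "axis3_sign s t i = (if i = 3 then t else s)"

lemma diagonal_matrix_sum: "(\<Sum>j\<in>UNIV. diagonal_matrix q $ i $ j * f j) = q i * f i"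
proof -
  have "diagonal_matrix q $ i $ j * f j = (if j = i then q i * f i else 0)" for j
    by (simp add: diagonal_matrix_def)
  then show ?thesis by simp
qed

lemma diagonal_matrix_mult:
  "diagonal_matrix p ** diagonal_matrix q = diagonal_matrix (\<lambda>i. p i * q i)"
  unfolding vec_eq_iff matrix_matrix_mult_def
  by (simp add: diagonal_matrix_sum) (simp add: diagonal_matrix_def)

lemma axis3_sign_mult: "axis3_sign s t i * axis3_sign s' t' i = axis3_sign (s * s') (t * t') i"
  by (simp add: axis3_sign_def)

lemma mat_1_diagonal: "mat 1 = diagonal_matrix (axis3_sign 1 1)"
  by (auto simp: mat_def diagonal_matrix_def axis3_sign_def vec_eq_iff)

lemma transpose_diagonal_matrix: "transpose (diagonal_matrix q) = diagonal_matrix q"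
  by (auto simp: transpose_def diagonal_matrix_def vec_eq_iff)

lemma rotation_e3_pi: "rotation_e3 pi = diagonal_matrix (axis3_sign (- 1) 1)"
  by (simp add: rotation_e3_def diagonal_matrix_def axis3_sign_def vec_eq_iff forall_3)

lemma rotation_in_Z2_Z2c: "rotation_e3 pi \<in> Z2_Z2c"
  unfolding Z2_Z2c_def Z2_def by (intro generate.incl UnI1) simp

definition sign_group :: "(real^3^3) set" where
  "sign_group = {diagonal_matrix (axis3_sign s t) | s t. s \<in> {1, -1} \<and> t \<in> {1, -1}}"

text \<open>Every element is symmetric and squares to the identity, hence is orthogonal and its own
  inverse.\<close>

lemma subgroup_sign_group: "subgroup sign_group O3"
proof (rule group.subgroupI[OF group_O3])
  have orth: "Q \<in> carrier O3 \<and> Q \<otimes>\<^bsub>O3\<^esub> Q = \<one>\<^bsub>O3\<^esub>" if "Q \<in> sign_group" for Q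
    using that
    by (auto simp: sign_group_def O3_def orthogonal_matrix_def transpose_diagonal_matrix
        diagonal_matrix_mult axis3_sign_mult mat_1_diagonal)
  then show "sign_group \<subseteq> carrier O3" by blast
  show "sign_group \<noteq> {}" by (auto simp: sign_group_def)
  fix P Q assume P: "P \<in> sign_group" and Q: "Q \<in> sign_group"
  show "inv\<^bsub>O3\<^esub> P \<in> sign_group"
    using P orth[OF P] group.inv_equality[OF group_O3, of P P] by simp
  show "P \<otimes>\<^bsub>O3\<^esub> Q \<in> sign_group"
  proof -
    obtain s t s' t' where P': "P = diagonal_matrix (axis3_sign s t)"
      and Q': "Q = diagonal_matrix (axis3_sign s' t')"
      and signs: "s \<in> {1, -1}" "t \<in> {1, -1}" "s' \<in> {1, -1}" "t' \<in> {1, -1}"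
      using P Q unfolding sign_group_def by blast
    have "P \<otimes>\<^bsub>O3\<^esub> Q = diagonal_matrix (axis3_sign (s * s') (t * t'))"
      by (simp add: P' Q' O3_def diagonal_matrix_mult axis3_sign_mult)
    moreover have "s * s' \<in> {1, -1}" "t * t' \<in> {1, -1}"
      using signs by auto
    ultimately show ?thesis
      unfolding sign_group_def by blast
  qed
qed

text \<open>A subgroup containing the generators contains what they generate. Invariance of a tensor
  can thus be checked on four diagonal matrices.\<close>

lemma Z2_Z2c_subset_sign_group: "Z2_Z2c \<subseteq> sign_group"
proof -
  have "rotation_e3 pi \<in> sign_group" "mat 1 \<in> sign_group"
    unfolding sign_group_def rotation_e3_pi mat_1_diagonal by blast+
  moreover have "- mat 1 = diagonal_matrix (axis3_sign (- 1) (- 1))"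
    by (auto simp: mat_def diagonal_matrix_def axis3_sign_def vec_eq_iff)
  then have "- mat 1 \<in> sign_group"
    unfolding sign_group_def by blast
  ultimately show ?thesis
    unfolding Z2_Z2c_def Z2_def Z2c_def
    by (intro group.generate_subgroup_incl[OF group_O3 _ subgroup_sign_group] Un_least) auto
qed

lemma diagonal_action4:
  "(\<Sum>j1\<in>UNIV. \<Sum>j2\<in>UNIV. \<Sum>j3\<in>UNIV. \<Sum>j4\<in>UNIV.
      diagonal_matrix q $ i1 $ j1 * diagonal_matrix q $ i2 $ j2 *
      diagonal_matrix q $ i3 $ j3 * diagonal_matrix q $ i4 $ j4 * T j1 j2 j3 j4) =
    q i1 * q i2 * q i3 * q i4 * T i1 i2 i3 i4"
  by (simp only: mult.assoc diagonal_matrix_sum flip: sum_distrib_left)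

text \<open>These span the symmetric matrices. The disjunction gives the value 1, not 2, on the
  diagonal when \<open>p = r\<close>, which causes the case splits on \<open>p = r\<close> in the
  contractions.\<close>

definition symmetric_unit :: "3 \<Rightarrow> 3 \<Rightarrow> 3 \<Rightarrow> 3 \<Rightarrow> real" where
  "symmetric_unit p r i j = of_bool (i = p \<and> j = r \<or> i = r \<and> j = p)"

text \<open>The test materials of the argument: symmetrising the tensor product of two symmetric
  units gives the major symmetry of \<open>C\<close>.\<close>

definition pair_stiffness :: "3 \<times> 3 \<Rightarrow> 3 \<times> 3 \<Rightarrow> tensor4" where
  "pair_stiffness = (\<lambda>(p, r) (p', r') i j l m.
     symmetric_unit p r i j * symmetric_unit p' r' l m +
     symmetric_unit p' r' i j * symmetric_unit p r l m)"

text \<open>Under diag(s, s, t) the unit of \<open>(p, r)\<close> is scaled by 1 if both or neither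
  of the indices are 3, and by \<open>s * t\<close> otherwise. If the two pairs have the same
  parity, the total factor is 1.\<close>

lemma pair_stiffness_in_monoclinic_class:
  assumes "(p = 3 \<longleftrightarrow> r = 3) \<longleftrightarrow> (p' = 3 \<longleftrightarrow> r' = 3)"
  shows "(pair_stiffness (p, r) (p', r'), \<lambda>i j k l m. 0, \<lambda>i j k l m n. 0) \<in> monoclinic_class"
proof -
  have "invariant4 Z2_Z2c (pair_stiffness (p, r) (p', r'))"
    unfolding invariant4_def
  proof (intro ballI allI)
    fix Q i1 i2 i3 i4 assume "Q \<in> Z2_Z2c"
    then obtain s t where Q: "Q = diagonal_matrix (axis3_sign s t)"
      and st: "s \<in> {1, -1}" "t \<in> {1, -1}"
      using Z2_Z2c_subset_sign_group by (auto simp: sign_group_def)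
    let ?q = "axis3_sign s t"
    have unit: "?q i * ?q j * symmetric_unit p r i j = ?q p * ?q r * symmetric_unit p r i j"
      for p r i j
      by (auto simp: symmetric_unit_def)
    have sign_one: "?q p * ?q r * (?q p' * ?q r') = 1"
    proof -
      have "?q i * ?q j = (if i = 3 \<longleftrightarrow> j = 3 then 1 else s * t)" for i j
        using st by (auto simp: axis3_sign_def)
      moreover have "s * t * (s * t) = 1"
        using st by auto
      ultimately show ?thesis
        using assms by simp
    qed
    have "?q i1 * ?q i2 * ?q i3 * ?q i4 * pair_stiffness (p, r) (p', r') i1 i2 i3 i4 =
        (?q i1 * ?q i2 * symmetric_unit p r i1 i2) * (?q i3 * ?q i4 * symmetric_unit p' r' i3 i4) +
        (?q i1 * ?q i2 * symmetric_unit p' r' i1 i2) * (?q i3 * ?q i4 * symmetric_unit p r i3 i4)"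
      by (simp add: pair_stiffness_def algebra_simps)
    also have "\<dots> = ?q p * ?q r * (?q p' * ?q r') * pair_stiffness (p, r) (p', r') i1 i2 i3 i4"
      unfolding unit[where p = p and r = r and i = i1 and j = i2]
        unit[where p = p and r = r and i = i3 and j = i4]
        unit[where p = p' and r = r' and i = i1 and j = i2]
        unit[where p = p' and r = r' and i = i3 and j = i4]
      by (simp add: pair_stiffness_def algebra_simps)
    finally show "(\<Sum>j1\<in>UNIV. \<Sum>j2\<in>UNIV. \<Sum>j3\<in>UNIV. \<Sum>j4\<in>UNIV.
        Q $ i1 $ j1 * Q $ i2 $ j2 * Q $ i3 $ j3 * Q $ i4 $ j4 *
        pair_stiffness (p, r) (p', r') j1 j2 j3 j4) = pair_stiffness (p, r) (p', r') i1 i2 i3 i4"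
      unfolding Q diagonal_action4 sign_one by simp
  qed
  moreover have "symmetric_unit p r i j = symmetric_unit p r j i" for p r i j
    by (auto simp: symmetric_unit_def)
  then have "pair_stiffness (p, r) (p', r') i j l m = pair_stiffness (p, r) (p', r') j i l m"
    "pair_stiffness (p, r) (p', r') i j l m = pair_stiffness (p, r) (p', r') l m i j" for i j l m
    unfolding pair_stiffness_def case_prod_conv by (metis, simp add: mult.commute)
  moreover have "invariant6 Z2_Z2c (\<lambda>i j k l m n. 0)"
    by (simp add: invariant6_def)
  ultimately show ?thesis
    unfolding monoclinic_class_def strain_gradient_materials_def mem_Collect_eq case_prod_conv
    by blast
qed

text \<open>The rotation by pi multiplies such a component by -1, so it equals its own
  negative.\<close>

lemma monoclinic_stiffness_odd:
  assumes "invariant4 Z2_Z2c C" "(i = 3 \<longleftrightarrow> j = 3) \<noteq> (l = 3 \<longleftrightarrow> m = 3)"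
  shows "C i j l m = 0"
proof -
  let ?q = "axis3_sign (- 1) 1"
  have "?q i * ?q j * ?q l * ?q m * C i j l m = C i j l m"
    using assms(1)[unfolded invariant4_def, rule_format, OF rotation_in_Z2_Z2c, of i j l m]
    unfolding rotation_e3_pi diagonal_action4 .
  moreover have "?q i * ?q j = (if i = 3 \<longleftrightarrow> j = 3 then 1 else - 1)" for i j
    by (simp add: axis3_sign_def)
  ultimately show ?thesis
    using assms(2) by (simp add: mult.assoc[of "?q i * ?q j"] split: if_splits)
qed

section \<open>The linear system for the strain gradient\<close>

lemma symmetric_unit_sum:
  "(\<Sum>j\<in>UNIV. symmetric_unit p r i j * g j) = (if i = p then g r else if i = r then g p else 0)"
proof -
  have "symmetric_unit p r i j * g j =
      (if i = p then if j = r then g j else 0 else if i = r then if j = p then g j else 0 else 0)" for j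
    by (auto simp: symmetric_unit_def)
  then show ?thesis by simp
qed

text \<open>An off-diagonal unit meets both \<open>f p r\<close> and \<open>f r p\<close>, hence the
  factor 2.\<close>

lemma symmetric_unit_contraction:
  fixes f :: "3 \<Rightarrow> 3 \<Rightarrow> real"
  assumes "f r p = f p r"
  shows "(\<Sum>l\<in>UNIV. \<Sum>m\<in>UNIV. symmetric_unit p r l m * f l m) = (if p = r then 1 else 2) * f p r"
proof -
  have "(if l = p then f l r else if l = r then f l p else 0) =
      (if l = p then f l r else 0) + (if l = r then if p = r then 0 else f l p else 0)" for l
    by auto
  then have "(\<Sum>l\<in>UNIV. \<Sum>m\<in>UNIV. symmetric_unit p r l m * f l m) =
      (\<Sum>l\<in>UNIV. if l = p then f l r else 0) +
      (\<Sum>l\<in>UNIV. if l = r then if p = r then 0 else f l p else 0)"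
    by (simp only: symmetric_unit_sum sum.distrib)
  then show ?thesis
    using assms by (simp only: sum.delta finite UNIV_I if_True) auto
qed

text \<open>With \<open>d l m j\<close> in the role of
  \<open>e\<^sub>l\<^sub>m\<^sub>,\<^sub>j\<close>, the left side is the divergence of the stress of
  a test material. Contracting over \<open>l\<close> and \<open>m\<close> first leaves a symmetric
  unit in \<open>i\<close> and \<open>j\<close>, which selects at most one \<open>j\<close> in each
  of the two terms.\<close>

lemma pair_stiffness_divergence:
  fixes d :: "3 \<Rightarrow> 3 \<Rightarrow> 3 \<Rightarrow> real"
  assumes sym: "\<And>l m j. d l m j = d m l j"
  shows "(\<Sum>j\<in>UNIV. \<Sum>l\<in>UNIV. \<Sum>m\<in>UNIV. pair_stiffness (p, r) (p', r') i j l m * d l m j) =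
    (if p' = r' then 1 else 2) * (if i = p then d p' r' r else if i = r then d p' r' p else 0) +
    (if p = r then 1 else 2) * (if i = p' then d p r r' else if i = r' then d p r p' else 0)"
proof -
  have "(\<Sum>l\<in>UNIV. \<Sum>m\<in>UNIV. pair_stiffness (p, r) (p', r') i j l m * d l m j) =
      symmetric_unit p r i j * (\<Sum>l\<in>UNIV. \<Sum>m\<in>UNIV. symmetric_unit p' r' l m * d l m j) +
      symmetric_unit p' r' i j * (\<Sum>l\<in>UNIV. \<Sum>m\<in>UNIV. symmetric_unit p r l m * d l m j)" for j
    by (simp add: pair_stiffness_def distrib_right sum.distrib mult.assoc sum_distrib_left)
  then have "(\<Sum>j\<in>UNIV. \<Sum>l\<in>UNIV. \<Sum>m\<in>UNIV. pair_stiffness (p, r) (p', r') i j l m * d l m j) =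
      (\<Sum>j\<in>UNIV. symmetric_unit p r i j * ((if p' = r' then 1 else 2) * d p' r' j)) +
      (\<Sum>j\<in>UNIV. symmetric_unit p' r' i j * ((if p = r then 1 else 2) * d p r j))"
    using symmetric_unit_contraction[of "\<lambda>l m. d l m _", OF sym] by (simp add: sum.distrib)
  then show ?thesis
    unfolding symmetric_unit_sum by simp
qed

text \<open>Pointwise linear algebra: of the 18 components of \<open>d\<close>, the test equations
  annihilate 16 and make the remaining two opposite.\<close>

lemma strain_gradient_equations:
  fixes d :: "3 \<Rightarrow> 3 \<Rightarrow> 3 \<Rightarrow> real"
  assumes sym: "\<And>l m j. d l m j = d m l j"
    and eq: "\<And>p r p' r' i. (p = 3 \<longleftrightarrow> r = 3) \<longleftrightarrow> (p' = 3 \<longleftrightarrow> r' = 3) \<Longrightarrow>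
      (\<Sum>j\<in>UNIV. \<Sum>l\<in>UNIV. \<Sum>m\<in>UNIV. pair_stiffness (p, r) (p', r') i j l m * d l m j) = 0"
  shows "d l m j = (if (l, m, j) \<in> {(1, 3, 2), (3, 1, 2)} then d 1 3 2
    else if (l, m, j) \<in> {(2, 3, 1), (3, 2, 1)} then - d 1 3 2 else 0)"
proof -
  have s: "d 2 1 k = d 1 2 k" "d 3 1 k = d 1 3 k" "d 3 2 k = d 2 3 k" for k
    using sym by auto
  \<comment> \<open>The instances below list \<open>p r p' r' i\<close>: the two index pairs of the
    stiffness, then the number of the equilibrium equation.\<close>
  note e = eq[unfolded pair_stiffness_divergence[OF sym]]
  have d111: "d 1 1 1 = 0" using e[of 1 1 1 1 1] by simp
  have d222: "d 2 2 2 = 0" using e[of 2 2 2 2 2] by simp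
  have d333: "d 3 3 3 = 0" using e[of 3 3 3 3 3] by simp
  have d221: "d 2 2 1 = 0" "d 1 1 2 = 0"
    using e[of 1 1 2 2 1] e[of 1 1 2 2 2] d111 d222 by simp_all
  have d331: "d 3 3 1 = 0" "d 1 1 3 = 0"
    using e[of 1 1 3 3 1] e[of 1 1 3 3 3] d111 d333 by simp_all
  have d332: "d 3 3 2 = 0" "d 2 2 3 = 0"
    using e[of 2 2 3 3 2] e[of 2 2 3 3 3] d222 d333 by simp_all
  have d121: "d 1 2 1 = 0" "d 1 2 2 = 0"
    using e[of 1 2 1 2 1] e[of 1 2 1 2 2] by (simp_all add: s)
  have d123: "d 1 2 3 = 0" using e[of 1 2 3 3 3] d331 d332 by (simp add: s)
  have d131: "d 1 3 1 = 0" "d 1 3 3 = 0"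
    using e[of 1 3 1 3 1] e[of 1 3 1 3 3] by (simp_all add: s)
  have d232: "d 2 3 2 = 0" "d 2 3 3 = 0"
    using e[of 2 3 2 3 2] e[of 2 3 2 3 3] by (simp_all add: s)
  \<comment> \<open>The stiffness coupling the shears 23 and 13, in the third equation, relates the
    two components that survive.\<close>
  have d231: "d 2 3 1 = - d 1 3 2" using e[of 2 3 1 3 3] by (simp add: s)
  note d_values = d111 d222 d333 d221 d331 d332 d121 d123 d131 d232 d231
  show ?thesis
    using exhaust_3[of l] exhaust_3[of m] exhaust_3[of j]
    by (elim disjE) (simp_all add: s d_values index3_distinct)
qed

subsection \<open>Universal displacements\<close>

lemma strain_symmetric: "strain u l m = strain u m l"
  by (simp add: strain_def fun_eq_iff add.commute)

lemma smooth_strain: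
  assumes \<Omega>: "open \<Omega>" and u: "displacement_field \<Omega> u"
  shows "smooth_on \<Omega> (strain u l m)"
  unfolding strain_def[abs_def]
  by (intro smooth_on_bounded_linear[OF \<Omega> bounded_linear_divide] smooth_on_add[OF \<Omega>]
      smooth_on_partial_deriv smooth_component[OF \<Omega> u])

lemma strain_differentiable:
  assumes \<Omega>: "open \<Omega>" and u: "displacement_field \<Omega> u"
    and x: "x \<in> \<Omega>"
  shows "strain u l m differentiable (at x)"
  using smooth_on_differentiable[OF smooth_strain[OF \<Omega> u] x] .

lemma partial_deriv_strain:
  assumes \<Omega>: "open \<Omega>" and u: "displacement_field \<Omega> u"
    and x: "x \<in> \<Omega>"
  shows "partial_deriv k (strain u l m) x = (second_deriv u l m k x + second_deriv u m l k x) / 2"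
proof -
  have d: "partial_deriv j (\<lambda>y. u y $ i) differentiable (at x)" for i j
    using smooth_on_differentiable[OF smooth_on_partial_deriv[OF smooth_component[OF \<Omega> u]] x] .
  have "strain u l m =
      (\<lambda>x. 1 / 2 * (partial_deriv m (\<lambda>y. u y $ l) x + partial_deriv l (\<lambda>y. u y $ m) x))"
    by (simp add: strain_def fun_eq_iff)
  moreover have "partial_deriv k (\<lambda>x. 1 / 2 *
      (partial_deriv m (\<lambda>y. u y $ l) x + partial_deriv l (\<lambda>y. u y $ m) x)) x =
      (second_deriv u l m k x + second_deriv u m l k x) / 2"
    by (simp add: partial_deriv_cmult partial_deriv_add differentiable_add d del: times_divide_eq_left)
  ultimately show ?thesis by simp
qed

text \<open>After expanding the strains, four of the six terms cancel because mixed derivatives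
  commute; the other two are both half of the left side.\<close>

lemma second_deriv_eq_strain_derivs:
  assumes \<Omega>: "open \<Omega>" and u: "displacement_field \<Omega> u"
    and x: "x \<in> \<Omega>"
  shows "second_deriv u i j k x = partial_deriv k (strain u i j) x +
    partial_deriv j (strain u i k) x - partial_deriv i (strain u j k) x"
  using partial_deriv_commute[OF \<Omega> x smooth_component[OF \<Omega> u]]
  by (simp add: partial_deriv_strain[OF \<Omega> u x] field_simps)

lemma partial_deriv_stress:
  assumes \<Omega>: "open \<Omega>" and u: "displacement_field \<Omega> u"
    and x: "x \<in> \<Omega>"
  shows "partial_deriv k (stress (C, \<lambda>i j k l m. 0, A) u i j) x =
    (\<Sum>l\<in>UNIV. \<Sum>m\<in>UNIV. C i j l m * partial_deriv k (strain u l m) x)"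
proof -
  have "stress (C, \<lambda>i j k l m. 0, A) u i j = (\<lambda>x. \<Sum>l\<in>UNIV. \<Sum>m\<in>UNIV. C i j l m * strain u l m x)"
    by (simp add: fun_eq_iff)
  then show ?thesis
    using x
    by (simp add: partial_deriv_sum partial_deriv_cmult strain_differentiable[OF \<Omega> u]
        differentiable_sum differentiable_mult)
qed

text \<open>For a test material both \<open>M\<close> and \<open>A\<close> are zero, so the
  hyper-stress vanishes and equilibrium says that the stress is divergence free.\<close>

lemma universal_imp_strain_equations:
  assumes \<Omega>: "open \<Omega>" and u: "displacement_field \<Omega> u"
    and univ: "universal_displacement \<Omega> monoclinic_class u" and x: "x \<in> \<Omega>"
    and parity: "(p = 3 \<longleftrightarrow> r = 3) \<longleftrightarrow> (p' = 3 \<longleftrightarrow> r' = 3)"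
  shows "(\<Sum>j\<in>UNIV. \<Sum>l\<in>UNIV. \<Sum>m\<in>UNIV.
    pair_stiffness (p, r) (p', r') i j l m * partial_deriv j (strain u l m) x) = 0"
proof -
  let ?\<mu> = "(pair_stiffness (p, r) (p', r'), \<lambda>i j k l m. 0, \<lambda>i j k l m n. 0)"
  have "hyper_stress ?\<mu> u i j k = (\<lambda>x. 0)" for i j k
    by (simp add: fun_eq_iff)
  then have "(\<Sum>j\<in>UNIV. partial_deriv j (stress ?\<mu> u i j) x) = 0"
    using univ x pair_stiffness_in_monoclinic_class[OF parity]
    unfolding universal_displacement_def equilibrium_def by (force simp: partial_deriv_const)
  then show ?thesis
    unfolding partial_deriv_stress[OF \<Omega> u x] .
qed

lemma universal_imp_second_derivs:
  assumes \<Omega>: "open \<Omega>" and u: "displacement_field \<Omega> u"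
    and convex: "convex \<Omega>" and univ: "universal_displacement \<Omega> monoclinic_class u"
  shows "\<exists>c. \<forall>x\<in>\<Omega>. \<forall>i j k. second_deriv u i j k x = twist c i j k"
proof -
  let ?e = "\<lambda>l m j. partial_deriv j (strain u l m)"
  have e: "?e l m j x = (if (l, m, j) \<in> {(1, 3, 2), (3, 1, 2)} then ?e 1 3 2 x
    else if (l, m, j) \<in> {(2, 3, 1), (3, 2, 1)} then - ?e 1 3 2 x else 0)" if "x \<in> \<Omega>" for l m j x
    by (rule strain_gradient_equations)
      (use that univ universal_imp_strain_equations[OF \<Omega> u] strain_symmetric in auto)
  have vanish: "partial_deriv k (?e l m j) x = 0"
    if "x \<in> \<Omega>" "\<And>y. y \<in> \<Omega> \<Longrightarrow> ?e l m j y = 0" for k l m j x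
    using partial_deriv_cong[OF \<Omega> that] by (simp add: partial_deriv_const)
  have commute: "partial_deriv k (?e l m j) x = partial_deriv j (?e l m k) x" if "x \<in> \<Omega>" for k l m j x
    using partial_deriv_commute[OF \<Omega> that smooth_strain[OF \<Omega> u]] .
  have "partial_deriv k (?e 1 3 2) x = 0" if x: "x \<in> \<Omega>" for k x
  proof -
    \<comment> \<open>In direction 2 an exchange of derivatives in \<open>?e 1 3 2\<close> gives
      nothing. Passing to \<open>- ?e 2 3 1\<close> first allows an exchange that reaches the
      vanishing \<open>?e 2 3 2\<close>.\<close>
    have "partial_deriv 2 (?e 1 3 2) x = partial_deriv 2 (\<lambda>y. - 1 * ?e 2 3 1 y) x"
      by (rule partial_deriv_cong[OF \<Omega> x]) (simp add: e[where l = 2 and m = 3 and j = 1])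
    also have "\<dots> = - 1 * partial_deriv 2 (?e 2 3 1) x"
      using smooth_on_differentiable[OF smooth_on_partial_deriv[OF smooth_strain[OF \<Omega> u]] x]
      by (rule partial_deriv_cmult)
    also have "partial_deriv 2 (?e 2 3 1) x = partial_deriv 1 (?e 2 3 2) x"
      by (rule commute[OF x])
    also have "\<dots> = 0"
      by (rule vanish[OF x]) (simp add: e)
    finally have "partial_deriv 2 (?e 1 3 2) x = 0" by simp
    moreover have "partial_deriv 1 (?e 1 3 2) x = partial_deriv 2 (?e 1 3 1) x"
      by (rule commute[OF x])
    moreover have "\<dots> = 0"
      by (rule vanish[OF x]) (simp add: e)
    moreover have "partial_deriv 3 (?e 1 3 2) x = partial_deriv 2 (?e 1 3 3) x"
      by (rule commute[OF x])
    moreover have "\<dots> = 0"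
      by (rule vanish[OF x]) (simp add: e)
    ultimately show ?thesis
      using exhaust_3[of k] by auto
  qed
  then have "\<exists>b. \<forall>x\<in>\<Omega>. ?e 1 3 2 x = 0 + b"
    using smooth_on_differentiable[OF smooth_on_partial_deriv[OF smooth_strain[OF \<Omega> u]]]
    by (intro equal_partial_derivs_imp_differ_by_const[OF convex]) (auto simp: partial_deriv_const)
  then obtain b where b: "\<And>x. x \<in> \<Omega> \<Longrightarrow> ?e 1 3 2 x = b" by auto
  \<comment> \<open>The factor 2 comes from \<open>u\<^sub>1\<^sub>,\<^sub>2\<^sub>3 =
    e\<^sub>1\<^sub>2\<^sub>,\<^sub>3 + e\<^sub>1\<^sub>3\<^sub>,\<^sub>2 -
    e\<^sub>2\<^sub>3\<^sub>,\<^sub>1\<close>, which is \<open>0 + b - (- b)\<close>.\<close>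
  have "second_deriv u i j k x = twist (2 * b) i j k" if x: "x \<in> \<Omega>" for i j k x
    unfolding second_deriv_eq_strain_derivs[OF \<Omega> u x] e[OF x, where l = i and m = j and j = k]
      e[OF x, where l = i and m = k and j = j] e[OF x, where l = j and m = k and j = i] b[OF x]
    using exhaust_3[of i] exhaust_3[of j] exhaust_3[of k] by (elim disjE) (simp_all add: twist_def index3_distinct)
  then show ?thesis by blast
qed

lemma second_derivs_imp_universal:
  assumes \<Omega>: "open \<Omega>" and u: "displacement_field \<Omega> u"
    and D: "\<forall>x\<in>\<Omega>. \<forall>i j k. second_deriv u i j k x = twist c i j k"
  shows "universal_displacement \<Omega> monoclinic_class u"
  unfolding universal_displacement_def
proof
  fix \<mu> assume "\<mu> \<in> monoclinic_class"
  then obtain C A where \<mu>: "\<mu> = (C, \<lambda>i j k l m. 0, A)"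
    and sym: "\<And>i j l m. C i j l m = C j i l m" "\<And>i j l m. C i j l m = C l m i j"
    and inv: "invariant4 Z2_Z2c C"
    by (auto simp: monoclinic_class_def strain_gradient_materials_def)
  \<comment> \<open>The constant strain gradient. Up to symmetry its only possibly nonzero entries
    are \<open>d 1 3 2 = c / 2\<close> and \<open>d 2 3 1 = - c / 2\<close>; in
    \<open>d 1 2 3\<close> the two contributions cancel.\<close>
  define d where "d l m j = (twist c l m j + twist c m l j) / 2" for l m j
  have d: "partial_deriv j (strain u l m) x = d l m j" if "x \<in> \<Omega>" for x j l m
    using D that by (simp add: partial_deriv_strain[OF \<Omega> u] d_def)
  \<comment> \<open>The sum reduces to \<open>c * (C i 2 1 3 - C i 1 2 3)\<close>. For
    \<open>i = 1\<close> and \<open>i = 2\<close> both constants vanish by parity; for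
    \<open>i = 3\<close> they agree by the minor and major symmetries.\<close>
  have C_d: "(\<Sum>j\<in>UNIV. \<Sum>l\<in>UNIV. \<Sum>m\<in>UNIV. C i j l m * d l m j) = 0" for i
  proof -
    have "C 1 1 2 3 = 0" "C 1 2 1 3 = 0" "C 2 1 2 3 = 0" "C 2 2 1 3 = 0"
      by (auto intro: monoclinic_stiffness_odd[OF inv])
    moreover have "C 3 2 1 3 = C 3 1 2 3"
      using sym by metis
    moreover have "C i j 3 1 = C i j 1 3" "C i j 3 2 = C i j 2 3" for i j
      using sym by metis+
    ultimately show ?thesis
      using exhaust_3[of i] by (elim disjE) (simp_all add: d_def twist_def sum_3 index3_distinct)
  qed
  have hyper: "hyper_stress \<mu> u i j k x =
      (\<Sum>l\<in>UNIV. \<Sum>m\<in>UNIV. \<Sum>n\<in>UNIV. A i j k l m n * d l m n)" if "x \<in> \<Omega>" for i j k x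
    using that by (simp add: \<mu> d)
  have "partial_deriv j (hyper_stress \<mu> u i j k) x = 0" if "x \<in> \<Omega>" for i j k x
    using partial_deriv_cong[OF \<Omega> that hyper] by (simp add: partial_deriv_const)
  then have "partial_deriv k (partial_deriv j (hyper_stress \<mu> u i j k)) x = 0" if "x \<in> \<Omega>" for i j k x
    using partial_deriv_cong[OF \<Omega> that, of "partial_deriv j (hyper_stress \<mu> u i j k)" "\<lambda>x. 0" k]
    by (simp add: partial_deriv_const)
  moreover have "(\<Sum>j\<in>UNIV. partial_deriv j (stress \<mu> u i j) x) = 0" if "x \<in> \<Omega>" for i x
    using that by (simp add: \<mu> partial_deriv_stress[OF \<Omega> u] d C_d del: stress.simps)
  ultimately show "equilibrium \<Omega> \<mu> u"
    by (simp add: equilibrium_def)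
qed

lemma universal_iff_second_derivs_twist:
  assumes "open \<Omega>" "convex \<Omega>" "displacement_field \<Omega> u"
  shows "universal_displacement \<Omega> monoclinic_class u \<longleftrightarrow>
    (\<exists>c. \<forall>i. \<forall>x\<in>\<Omega>. \<forall>j k. second_deriv u i j k x = twist c i j k)"
  using universal_imp_second_derivs second_derivs_imp_universal assms by meson

theorem proposition3p4:
  fixes \<Omega> :: "(real^3) set" and u :: "real^3 \<Rightarrow> real^3"
  assumes "open \<Omega>" and "convex \<Omega>" and "\<Omega> \<noteq> {}"
    and "displacement_field \<Omega> u"
  shows "universal_displacement \<Omega> monoclinic_class u \<longleftrightarrow>
    (\<exists>(v :: real^3 \<Rightarrow> real^3) (c :: real). homogeneous_displacement \<Omega> v \<and>
       (\<forall>x\<in>\<Omega>. u x = v x + vector [c * x$2 * x$3, - c * x$1 * x$3, 0]))"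
  by (simp only: universal_iff_second_derivs_twist[OF assms(1,2,4)]
      second_derivs_twist_iff_quadratic[OF assms(1,2,4)] quadratic_twist_iff_homogeneous_plus_twist)

end
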